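(* If $\|B_k-G_\star\|\to0$, then the transported Dennis–Moré condition $$\frac{\|(B_k-\overline G_k)d_k\|}{\|d_k\|}\longrightarrow0$$ holds for every sequence of nonzero directions $d_k\to0$, independently of how the outer DRS step chooses those directions.
   Context: $\mathcal H$ is a finite-dimensional real Hilbert space, $f:\mathcal H\to\mathbb R$ is convex and twice continuously differentiable, $\gamma>0$, and $P_{\gamma f}z:=\arg\min_x\{\gamma f(x)+\frac12\|x-z\|^2\}$. For a sequence of centers $z_k$, $\phi_k(x):=\gamma f(x)+\frac12\|x-z_k\|^2$, $p_k:=P_{\gamma f}z_k$, and it is assumed that $p_k\to p_\star$, where $p_\star=P_{\gamma f}z_\star$ for the exact DRS fixed point $z_\star$. Directions are $d_k=a_{k-1}-p_k$ (with $a_{k-1}$ the anchor points), and $$\overline G_k:=\int_0^1\nabla^2\phi_k(p_k+td_k)\,dt=\int_0^1\bigl(I+\gamma\nabla^2f(p_k+td_k)\bigr)dt,\qquad G_\star:=I+\gamma\nabla^2f(p_\star).$$ $B_k$ are self-adjoint positive definite operators on $\mathcal H$ (direct quasi-Newton Hessian models). *)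

theory Defs
  imports "HOL-Analysis.Analysis"
begin

definition gradient :: "('a::euclidean_space \<Rightarrow> real) \<Rightarrow> 'a \<Rightarrow> 'a" where
  "gradient f x = (THE v. GDERIV f x :> v)"

text \<open>The Hessian as a bounded operator, so that \<open>norm\<close> is the operator norm on differences of
  Hessians and Hessian models, and \<open>integral\<close> is operator-valued.\<close>

definition hessian :: "('a::euclidean_space \<Rightarrow> real) \<Rightarrow> 'a \<Rightarrow> 'a \<Rightarrow>\<^sub>L 'a" where
  "hessian f x = Blinfun (frechet_derivative (gradient f) (at x))"

definition twice_continuously_differentiable :: "('a::euclidean_space \<Rightarrow> real) \<Rightarrow> bool" where
  "twice_continuously_differentiable f \<longleftrightarrow>
     (\<forall>x. f differentiable (at x)) \<and>
     (\<forall>x. gradient f differentiable (at x)) \<and>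
     continuous_on UNIV (hessian f)"

definition prox_objective :: "real \<Rightarrow> ('a::euclidean_space \<Rightarrow> real) \<Rightarrow> 'a \<Rightarrow> 'a \<Rightarrow> real" where
  "prox_objective \<gamma> f z x = \<gamma> * f x + 1/2 * (norm (x - z))\<^sup>2"

text \<open>For convex continuous \<open>f\<close> and \<open>\<gamma> > 0\<close> the objective is strongly convex, so the minimiser
  exists and is unique and the choice inside \<^const>\<open>arg_min\<close> is harmless.\<close>

definition prox :: "real \<Rightarrow> ('a::euclidean_space \<Rightarrow> real) \<Rightarrow> 'a \<Rightarrow> 'a" where
  "prox \<gamma> f z = (ARG_MIN (prox_objective \<gamma> f z) x. True)"

text \<open>Fixed points of the Douglas--Rachford step for \<open>f + g\<close>,
  \<open>z \<mapsto> z + prox\<^sub>\<gamma>\<^sub>g (2 p - z) - p\<close> with \<open>p = prox\<^sub>\<gamma>\<^sub>f z\<close>.  The second summand is extended-valued, and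
  its proximal point is expressed as a relation, so that no regularity of \<open>g\<close> has to be imposed;
  for proper, lower semicontinuous, convex \<open>g\<close> the point \<open>q\<close> is unique.\<close>

definition drs_fixed_point ::
    "real \<Rightarrow> ('a::euclidean_space \<Rightarrow> real) \<Rightarrow> ('a \<Rightarrow> ereal) \<Rightarrow> 'a \<Rightarrow> bool" where
  "drs_fixed_point \<gamma> f g z \<longleftrightarrow>
     (let p = prox \<gamma> f z in
      \<exists>q. is_arg_min (\<lambda>x. ereal \<gamma> * g x + ereal (1/2 * (norm (x - (2 *\<^sub>R p - z)))\<^sup>2)) (\<lambda>_. True) q \<and>
          z + (q - p) = z)"

definition self_adjoint :: "('a::euclidean_space \<Rightarrow>\<^sub>L 'a) \<Rightarrow> bool" where
  "self_adjoint A \<longleftrightarrow> (\<forall>x y. blinfun_apply A x \<bullet> y = x \<bullet> blinfun_apply A y)"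

definition positive_definite :: "('a::euclidean_space \<Rightarrow>\<^sub>L 'a) \<Rightarrow> bool" where
  "positive_definite A \<longleftrightarrow> (\<forall>x. x \<noteq> 0 \<longrightarrow> blinfun_apply A x \<bullet> x > 0)"

definition averaged_hessian :: "('a::euclidean_space \<Rightarrow> real) \<Rightarrow> 'a \<Rightarrow> 'a \<Rightarrow> 'a \<Rightarrow>\<^sub>L 'a" where
  "averaged_hessian \<phi> p d = integral {0..1} (\<lambda>t. hessian \<phi> (p + t *\<^sub>R d))"

end

theory Submission
  imports Defs
begin

text \<open>The Hessian of \<open>\<phi>\<^sub>k\<close> is \<open>I + \<gamma> \<nabla>\<^sup>2f\<close> and does not involve the centre \<open>z\<^sub>k\<close>.  The segments
  from \<open>p\<^sub>k\<close> to \<open>p\<^sub>k + d\<^sub>k\<close> shrink to \<open>p\<^sub>\<star>\<close>, so by continuity of \<open>\<nabla>\<^sup>2f\<close> the averaged Hessians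
  converge to \<open>G\<^sub>\<star>\<close> in operator norm, whatever the directions are.  The quotient
  is at most the operator norm of the difference of \<open>B\<^sub>k\<close> and the averaged Hessian.\<close>

lemma gderiv_unique:
  fixes f :: "'a::euclidean_space \<Rightarrow> real"
  assumes "GDERIV f x :> u" "GDERIV f x :> v"
  shows "u = v"
proof -
  have "(\<lambda>h. h \<bullet> u) = (\<lambda>h. h \<bullet> v)"
    using assms unfolding gderiv_def by (rule has_derivative_unique)
  then show ?thesis
    by (metis inner_commute vector_eq_rdot)
qed

lemma gradient_eqI:
  assumes "GDERIV f x :> v"
  shows "gradient f x = v"
  unfolding gradient_def using assms gderiv_unique by blast

lemma gderiv_gradient:
  assumes "f differentiable (at x)"
  shows "GDERIV f x :> gradient f x"
proof -
  obtain f' where f': "(f has_derivative f') (at x)"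
    using assms by (auto simp: differentiable_def)
  \<comment> \<open>Riesz representation in one line: \<open>f' h\<close> is the real inner product
    of \<open>f' h\<close> with \<open>1\<close>, and moving \<open>f'\<close> across it gives the
    representing vector \<open>adjoint f' 1\<close>.\<close>
  have "f' = (\<lambda>h. h \<bullet> adjoint f' 1)"
    using adjoint_works[OF has_derivative_linear[OF f']] by (simp add: fun_eq_iff)
  with f' have "GDERIV f x :> adjoint f' 1"
    by (simp add: gderiv_def)
  with gradient_eqI show ?thesis by metis
qed

lemma hessian_eqI:
  assumes "(gradient f has_derivative blinfun_apply H) (at x)"
  shows "hessian f x = H"
  unfolding hessian_def frechet_derivative_at[OF assms, symmetric]
  by (rule blinfun_apply_inverse)

text \<open>\<open>Blinfun\<close> is meaningful only on bounded linear maps. A Frechet derivative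
  is one, so wrapping it as an operator loses nothing.\<close>

lemma has_derivative_gradient:
  assumes "gradient f differentiable (at x)"
  shows "(gradient f has_derivative blinfun_apply (hessian f x)) (at x)"
proof -
  have *: "(gradient f has_derivative frechet_derivative (gradient f) (at x)) (at x)"
    using assms by (simp add: frechet_derivative_works)
  then show ?thesis
    by (simp add: hessian_def bounded_linear_Blinfun_apply has_derivative_bounded_linear)
qed

lemma gradient_prox_objective:
  assumes "f differentiable (at x)"
  shows "gradient (prox_objective \<gamma> f z) x = \<gamma> *\<^sub>R gradient f x + (x - z)"
proof (rule gradient_eqI)
  have "(f has_derivative (\<lambda>h. h \<bullet> gradient f x)) (at x)"
    using gderiv_gradient[OF assms] by (simp add: gderiv_def)
  then have "((\<lambda>x. \<gamma> * f x + 1/2 * ((x - z) \<bullet> (x - z))) has_derivative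
      (\<lambda>h. h \<bullet> (\<gamma> *\<^sub>R gradient f x + (x - z)))) (at x)"
    by (auto intro!: derivative_eq_intros simp: algebra_simps inner_commute)
  then show "GDERIV (prox_objective \<gamma> f z) x :> \<gamma> *\<^sub>R gradient f x + (x - z)"
    by (simp add: gderiv_def prox_objective_def[abs_def] power2_norm_eq_inner)
qed

lemma hessian_prox_objective:
  assumes "twice_continuously_differentiable f"
  shows "hessian (prox_objective \<gamma> f z) x = id_blinfun + \<gamma> *\<^sub>R hessian f x"
proof (rule hessian_eqI)
  have diff: "\<And>x. f differentiable (at x)" "gradient f differentiable (at x)"
    using assms by (auto simp: twice_continuously_differentiable_def)
  \<comment> \<open>The identity is needed as an equation of functions, since it is differentiated
    once more. The centre then enters only through the constant \<open>- z\<close>.\<close>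
  have "gradient (prox_objective \<gamma> f z) = (\<lambda>x. \<gamma> *\<^sub>R gradient f x + (x - z))"
    using gradient_prox_objective[OF diff(1)] by (rule ext)
  then show "(gradient (prox_objective \<gamma> f z) has_derivative
      blinfun_apply (id_blinfun + \<gamma> *\<^sub>R hessian f x)) (at x)"
    using has_derivative_gradient[OF diff(2)]
    by (auto intro!: derivative_eq_intros simp: blinfun.bilinear_simps)
qed

text \<open>\<open>integral\<close> is 0 on functions that are not integrable, so additivity and
  norm bounds for averaged Hessians rest on this fact.\<close>

lemma hessian_integrable_on_segment:
  assumes "twice_continuously_differentiable f"
  shows "(\<lambda>t. hessian f (p + t *\<^sub>R d)) integrable_on {0..1}"
proof (rule integrable_continuous_interval)
  have "continuous_on UNIV (hessian f)"
    using assms by (simp add: twice_continuously_differentiable_def)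
  then show "continuous_on {0..1} (\<lambda>t. hessian f (p + t *\<^sub>R d))"
    by (rule continuous_on_compose2) (auto intro!: continuous_intros)
qed

text \<open>The interval of integration has length 1, so the constant \<open>id_blinfun\<close> is
  its own average.\<close>

lemma averaged_hessian_prox_objective:
  assumes "twice_continuously_differentiable f"
  shows "averaged_hessian (prox_objective \<gamma> f z) p d
    = id_blinfun + \<gamma> *\<^sub>R averaged_hessian f p d"
  unfolding averaged_hessian_def hessian_prox_objective[OF assms]
  by (subst integral_add)
    (auto intro: integrable_cmul hessian_integrable_on_segment[OF assms])

text \<open>Once \<open>p k\<close> is within \<open>r / 2\<close> of \<open>q\<close> and
  \<open>d k\<close> is shorter than \<open>r / 2\<close>, the whole segment lies in the ball of
  radius \<open>r\<close> about \<open>q\<close>. A bound valid on that ball passes to the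
  average.\<close>

lemma tendsto_averaged_hessian:
  fixes F :: "'b filter"
  assumes f: "twice_continuously_differentiable f"
    and p: "(p \<longlongrightarrow> q) F" and d: "(d \<longlongrightarrow> 0) F"
  shows "((\<lambda>k. averaged_hessian f (p k) (d k)) \<longlongrightarrow> hessian f q) F"
proof (rule tendstoI)
  fix e :: real
  assume "e > 0"
  have "isCont (hessian f) q"
    using f by (simp add: twice_continuously_differentiable_def continuous_on_eq_continuous_at)
  \<comment> \<open>The integral estimate below is only a weak inequality; \<open>e / 2\<close>
    leaves room for the strict bound by \<open>e\<close>.\<close>
  then obtain r where "r > 0"
    and r: "\<And>x. dist x q < r \<Longrightarrow> dist (hessian f x) (hessian f q) < e / 2"
    using \<open>e > 0\<close> unfolding continuous_at_eps_delta by (metis half_gt_zero)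
  have "\<forall>\<^sub>F k in F. dist (p k) q < r / 2" "\<forall>\<^sub>F k in F. dist (d k) 0 < r / 2"
    using tendstoD[OF p, of "r / 2"] tendstoD[OF d, of "r / 2"] \<open>r > 0\<close> by simp_all
  then show "\<forall>\<^sub>F k in F. dist (averaged_hessian f (p k) (d k)) (hessian f q) < e"
  proof eventually_elim
    case (elim k)
    have close: "norm (hessian f (p k + t *\<^sub>R d k) - hessian f q) \<le> e / 2"
      if "t \<in> {0..1}" for t
    proof -
      have "norm (t *\<^sub>R d k) \<le> norm (d k)"
        using that by (simp add: mult_left_le_one_le)
      moreover have "norm ((p k - q) + t *\<^sub>R d k) \<le> norm (p k - q) + norm (t *\<^sub>R d k)"
        by (rule norm_triangle_ineq)
      ultimately have "dist (p k + t *\<^sub>R d k) q < r"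
        using elim by (simp add: dist_norm algebra_simps)
      from r[OF this] show ?thesis
        by (simp add: dist_norm)
    qed
    \<comment> \<open>The constant \<open>hessian f q\<close> integrates to itself over the unit
      interval, so the error of the average is the average of the errors.\<close>
    have "((\<lambda>t. hessian f (p k + t *\<^sub>R d k) - hessian f q) has_integral
        (averaged_hessian f (p k) (d k) - hessian f q)) {0..1}"
      using has_integral_diff[OF integrable_integral[OF hessian_integrable_on_segment[OF f]]
          has_integral_const_real[of "hessian f q" 0 1]]
      by (simp add: averaged_hessian_def)
    from has_integral_bound_real[OF _ finite.emptyI this, of "e / 2"] close
    have "norm (averaged_hessian f (p k) (d k) - hessian f q) \<le> e / 2"
      using \<open>e > 0\<close> by simp
    then show ?case
      using \<open>e > 0\<close> by (simp add: dist_norm)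
  qed
qed

theorem corollary5p2:
  fixes f :: "'a::euclidean_space \<Rightarrow> real"
    and g :: "'a \<Rightarrow> ereal"
    and \<gamma> :: real
    and z p :: "nat \<Rightarrow> 'a"
    and z_star p_star :: 'a
    and B :: "nat \<Rightarrow> 'a \<Rightarrow>\<^sub>L 'a"
    and G_star :: "'a \<Rightarrow>\<^sub>L 'a"
  assumes "convex_on UNIV f"
    and "twice_continuously_differentiable f"
    and "\<gamma> > 0"
    and "\<And>k. p k = prox \<gamma> f (z k)"
    and "drs_fixed_point \<gamma> f g z_star"
    and "p_star = prox \<gamma> f z_star"
    and "p \<longlonglongrightarrow> p_star"
    and "G_star = id_blinfun + \<gamma> *\<^sub>R hessian f p_star"
    and "\<And>k. self_adjoint (B k)"
    and "\<And>k. positive_definite (B k)"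
    and "(\<lambda>k. norm (B k - G_star)) \<longlonglongrightarrow> 0"
  shows "\<forall>(a :: nat \<Rightarrow> 'a) (d :: nat \<Rightarrow> 'a) (G_bar :: nat \<Rightarrow> 'a \<Rightarrow>\<^sub>L 'a).
           (\<forall>k\<ge>1. d k = a (k - 1) - p k) \<longrightarrow>
           (\<forall>k\<ge>1. d k \<noteq> 0) \<longrightarrow>
           d \<longlonglongrightarrow> 0 \<longrightarrow>
           (\<forall>k\<ge>1. G_bar k = averaged_hessian (prox_objective \<gamma> f (z k)) (p k) (d k)) \<longrightarrow>
           (\<lambda>k. norm (blinfun_apply (B k - G_bar k) (d k)) / norm (d k)) \<longlonglongrightarrow> 0"
proof (intro allI impI)
  fix a d :: "nat \<Rightarrow> 'a" and G_bar :: "nat \<Rightarrow> 'a \<Rightarrow>\<^sub>L 'a"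
  assume "d \<longlonglongrightarrow> 0"
    and G_bar: "\<forall>k\<ge>1. G_bar k = averaged_hessian (prox_objective \<gamma> f (z k)) (p k) (d k)"
  have "(\<lambda>k. id_blinfun + \<gamma> *\<^sub>R averaged_hessian f (p k) (d k)) \<longlonglongrightarrow> G_star"
    unfolding assms(8)
    by (intro tendsto_intros tendsto_averaged_hessian assms(2,7) \<open>d \<longlonglongrightarrow> 0\<close>)
  \<comment> \<open>\<open>G_bar\<close> is prescribed only from index 1 on, because
    \<open>d k\<close> refers to \<open>a (k - 1)\<close>; \<open>G_bar 0\<close> is arbitrary and
    does not affect the limit.\<close>
  moreover have "\<forall>\<^sub>F k in sequentially. id_blinfun + \<gamma> *\<^sub>R averaged_hessian f (p k) (d k) = G_bar k"
    using eventually_ge_at_top[of 1]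
    by eventually_elim (simp add: G_bar averaged_hessian_prox_objective[OF assms(2)])
  ultimately have "G_bar \<longlonglongrightarrow> G_star"
    by (rule Lim_transform_eventually)
  moreover have "B \<longlonglongrightarrow> G_star"
    using assms(11) by (simp add: tendsto_norm_zero_iff LIM_zero_iff)
  ultimately have "(\<lambda>k. norm (B k - G_bar k)) \<longlonglongrightarrow> 0"
    using tendsto_diff[of B G_star sequentially G_bar G_star] by (simp add: tendsto_norm_zero)
  then show "(\<lambda>k. norm (blinfun_apply (B k - G_bar k) (d k)) / norm (d k)) \<longlonglongrightarrow> 0"
  proof (rule Lim_null_comparison[rotated])
    show "\<forall>\<^sub>F k in sequentially. norm (norm (blinfun_apply (B k - G_bar k) (d k)) / norm (d k))
        \<le> norm (B k - G_bar k)"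
      \<comment> \<open>The operator-norm bound divided by \<open>norm (d k)\<close>. Should
        \<open>d 0\<close> vanish, the quotient there is 0 by convention, so the estimate holds at
        every index.\<close>
      by (intro always_eventually allI) (simp add: divide_le_eq norm_blinfun)
  qed
qed

end
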